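(* Let $\{s_1,\dots,s_n\}$ be $n\ge3$ sites of $(S,\partial)$ which are neighbors of each other. Assume $\rho_{s_1,s_2}\ne0$, $\rho_{s_1,s_n}\neq0$, and $\tilde z_{s_1}^{\check u_1}\ne0$ for some $1\le\check u_1\le d_1$. If $n\ge4$, assume in addition that $$\rho_{s_2,s_k}=\frac{\rho_{s_2,s_n}\rho_{s_1,s_k}}{\rho_{s_1,s_n}}\quad(3\le k\le n-1),\qquad \rho_{s_i,s_j}=\frac{\rho_{s_1,s_i}\rho_{s_2,s_n}\rho_{s_1,s_j}}{\rho_{s_1,s_2}\rho_{s_1,s_n}}\quad(3\le i\ne j\le n-1),\qquad \rho_{s_k,s_n}=\frac{\rho_{s_2,s_n}\rho_{s_1,s_k}}{\rho_{s_1,s_2}}\quad(3\le k\le n-1).$$ Then a necessary and sufficient condition for the permutation property of the joint distribution of $X_{s_1},\dots,X_{s_n}$ is that $\hat y_{s_i}^{u_i}=\hat\pi_{s_i}(x_{s_i}^{u_i})-\pi_{s_i}(x_{s_i}^{u_i})$ ($1\le u_i\le d_i$, $1\le i\le n$) have the following closed form for some real number $y_{s_1}^{\check u_1}$ (a free variable): $$\hat y_{s_1}^{u_1}=\frac{\tilde z_{s_1}^{u_1}\,y_{s_1}^{\check u_1}}{\tilde z_{s_1}^{\check u_1}}\quad(1\le u_1\le d_1),$$ $$\hat y_{s_i}^{u_i}=\frac{\tilde\rho_{s_i,s_n}\,\tilde z_{s_i}^{u_i}\,y_{s_1}^{\check u_1}}{\tilde\rho_{s_1,s_n}\,\tilde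 z_{s_1}^{\check u_1}}\quad(1\le u_i\le d_i,\ 2\le i\le n-1),$$ $$\hat y_{s_n}^{u_n}=\frac{\tilde\rho_{s_2,s_n}\,\tilde z_{s_n}^{u_n}\,y_{s_1}^{\check u_1}}{\tilde\rho_{s_1,s_2}\,\tilde z_{s_1}^{\check u_1}}\quad(1\le u_n\le d_n).$$
   Context: $(S,\partial)$ is a connected finite space of sites with a neighborhood system $\partial$ ($s\notin\partial(s)$; $s\in\partial(t)$ iff $t\in\partial(s)$; $t$ is a neighbor of $s$ if $t\in\partial(s)$). For each $s_i$, $\mathbf{X}_{s_i}=\{x_{s_i}^1,\dots,x_{s_i}^{d_i}\}$ is a set of $d_i$ distinct reals; $\pi_{s_i}$ is a strictly positive pmf on $\mathbf{X}_{s_i}$, and $\tilde\pi_{s_i},\hat\pi_{s_i}$ are two auxiliary pmfs on $\mathbf{X}_{s_i}$. None of the pmfs $\pi_{s},\tilde\pi_{s},\hat\pi_{s}$ is degenerate (the law of a constant). $\mu_p$ and $\sigma_p^2$ denote mean and variance of a pmf $p$. $\beta_{s_i,s_j}=\beta_{s_j,s_i}$ ($i\neq j$) are real numbers (prescribed covariances). Put $$\rho_{s_i,s_j}=\frac{\beta_{s_i,s_j}}{\sigma_{\pi_{s_i}}\sigma_{\pi_{s_j}}},\qquad \tilde\rho_{s_i,s_j}=\frac{\beta_{s_i,s_j}}{\sigma_{\tilde\pi_{s_i}}\sigma_{\tilde\pi_{s_j}}},\qquad \tilde z_{s_i}^{u_i}=\frac{\tilde\pi_{s_i}(x_{s_i}^{u_i})(x_{s_i}^{u_i}-\mu_{\tilde\pi_{s_i}})}{\sigma_{\tilde\pi_{s_i}}}.$$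 For every ordering $t_1,\dots,t_n$ of the sites $s_1,\dots,s_n$, the joint pmf $\Pi_{t_1,\dots,t_n}$ of the field generated sequentially in this order is defined by $\Pi_{t_1}=\pi_{t_1}$ and, for $2\le i\le n$, $$\Pi_{t_1,\dots,t_i}(x_{t_1},\dots,x_{t_i})=\Pi_{t_1,\dots,t_{i-1}}(x_{t_1},\dots,x_{t_{i-1}})\,\pi_{t_i}(x_{t_i})+\frac{\tilde\pi_{t_i}(x_{t_i})(x_{t_i}-\mu_{\tilde\pi_{t_i}})}{\sigma^2_{\tilde\pi_{t_i}}}\sum_{j=1}^{i-1}\ \prod_{k=1,k\ne j}^{i-1}\hat\pi_{t_k}(x_{t_k})\cdot\frac{\beta_{t_i,t_j}\tilde\pi_{t_j}(x_{t_j})(x_{t_j}-\mu_{\tilde\pi_{t_j}})}{\sigma^2_{\tilde\pi_{t_j}}};$$ these functions are assumed to be pmfs (regularity). The permutation property of the joint distribution means: for every pair of permutations $g,h$ of $\{1,\dots,n\}$ and all $x_{s_i}\in\mathbf{X}_{s_i}$ ($1\le i\le n$), $$\Pi_{s_{g(1)},\dots,s_{g(n)}}(x_{s_{g(1)}},\dots,x_{s_{g(n)}})=\Pi_{s_{h(1)},\dots,s_{h(n)}}(x_{s_{h(1)}},\dots,x_{s_{h(n)}}).$$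
   Formalization: Necessity of the closed form is asserted only if ρ_{s_2,s_n}≠0 or d_1=2 (it fails when ρ_{s_2,s_n}=0 and d_1≥3, since then π̂_{s_1} does not enter the joint pmf); sufficiency is asserted in all cases. *)

theory Defs
  imports "HOL-Probability.Probability"
begin

locale site_space =
  fixes S :: "'s set" and nbr :: "'s \<Rightarrow> 's set"
  assumes finite_sites: "finite S"
    and nbr_subset: "\<And>s. s \<in> S \<Longrightarrow> nbr s \<subseteq> S"
    and nbr_irrefl: "\<And>s. s \<in> S \<Longrightarrow> s \<notin> nbr s"
    and nbr_sym: "\<And>s t. s \<in> S \<Longrightarrow> t \<in> S \<Longrightarrow> s \<in> nbr t \<longleftrightarrow> t \<in> nbr s"
    and connected: "\<And>s t. s \<in> S \<Longrightarrow> t \<in> S \<Longrightarrow> (s, t) \<in> {(a, b). a \<in> S \<and> b \<in> nbr a}\<^sup>*"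

definition mean :: "real pmf \<Rightarrow> real" where
  "mean p = measure_pmf.expectation p (\<lambda>a. a)"

definition var :: "real pmf \<Rightarrow> real" where
  "var p = measure_pmf.variance p (\<lambda>a. a)"

definition sd :: "real pmf \<Rightarrow> real" where
  "sd p = sqrt (var p)"

definition degenerate :: "real pmf \<Rightarrow> bool" where
  "degenerate p \<longleftrightarrow> (\<exists>c. p = return_pmf c)"

definition state_set :: "('s \<Rightarrow> nat) \<Rightarrow> ('s \<Rightarrow> nat \<Rightarrow> real) \<Rightarrow> 's \<Rightarrow> real set" where
  "state_set d x s = x s ` {1..d s}"

text \<open>\<open>x s u\<close>, for \<open>u = 1, \<dots>, d s\<close>, enumerates the values at the site \<open>s\<close>;
  \<open>\<pi>\<close> is the marginal, \<open>\<pi>t\<close> and \<open>\<pi>h\<close> are the two auxiliary pmfs (written with a tilde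
  and with a hat), and \<open>\<beta>\<close> is the prescribed covariance.\<close>

locale field_data = site_space S nbr
  for S :: "'s set" and nbr :: "'s \<Rightarrow> 's set" +
  fixes d :: "'s \<Rightarrow> nat" and x :: "'s \<Rightarrow> nat \<Rightarrow> real"
    and \<pi> \<pi>t \<pi>h :: "'s \<Rightarrow> real pmf" and \<beta> :: "'s \<Rightarrow> 's \<Rightarrow> real"
  assumes distinct_values: "\<And>s. s \<in> S \<Longrightarrow> inj_on (x s) {1..d s}"
    and pi_positive: "\<And>s. s \<in> S \<Longrightarrow> set_pmf (\<pi> s) = state_set d x s"
    and pit_support: "\<And>s. s \<in> S \<Longrightarrow> set_pmf (\<pi>t s) \<subseteq> state_set d x s"
    and pih_support: "\<And>s. s \<in> S \<Longrightarrow> set_pmf (\<pi>h s) \<subseteq> state_set d x s"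
    and nondegenerate: "\<And>s. s \<in> S \<Longrightarrow>
      \<not> degenerate (\<pi> s) \<and> \<not> degenerate (\<pi>t s) \<and> \<not> degenerate (\<pi>h s)"
    and beta_sym: "\<And>s t. s \<in> S \<Longrightarrow> t \<in> S \<Longrightarrow> s \<noteq> t \<Longrightarrow> \<beta> s t = \<beta> t s"

text \<open>Used with \<open>p = \<pi>\<close> for \<open>\<rho>\<close> and with \<open>p = \<pi>t\<close> for its tilde version.\<close>

definition rho :: "('s \<Rightarrow> real pmf) \<Rightarrow> ('s \<Rightarrow> 's \<Rightarrow> real) \<Rightarrow> 's \<Rightarrow> 's \<Rightarrow> real" where
  "rho p \<beta> s t = \<beta> s t / (sd (p s) * sd (p t))"

definition zt :: "('s \<Rightarrow> nat \<Rightarrow> real) \<Rightarrow> ('s \<Rightarrow> real pmf) \<Rightarrow> 's \<Rightarrow> nat \<Rightarrow> real" where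
  "zt x \<pi>t s u = pmf (\<pi>t s) (x s u) * (x s u - mean (\<pi>t s)) / sd (\<pi>t s)"

definition yh :: "('s \<Rightarrow> nat \<Rightarrow> real) \<Rightarrow> ('s \<Rightarrow> real pmf) \<Rightarrow> ('s \<Rightarrow> real pmf) \<Rightarrow> 's \<Rightarrow> nat \<Rightarrow> real" where
  "yh x \<pi> \<pi>h s u = pmf (\<pi>h s) (x s u) - pmf (\<pi> s) (x s u)"

text \<open>\<open>joint \<pi> \<pi>t \<pi>h \<beta> t i v\<close> is the value at the configuration \<open>v\<close> (a value for every site) of
  the joint pmf of the sites \<open>t 1, \<dots>, t i\<close> visited in this order. The recursion starts from the
  empty product; its first step gives \<open>pmf (\<pi> (t 1)) (v (t 1))\<close> because the sum is then empty.\<close>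

primrec joint ::
  "('s \<Rightarrow> real pmf) \<Rightarrow> ('s \<Rightarrow> real pmf) \<Rightarrow> ('s \<Rightarrow> real pmf) \<Rightarrow> ('s \<Rightarrow> 's \<Rightarrow> real) \<Rightarrow>
    (nat \<Rightarrow> 's) \<Rightarrow> nat \<Rightarrow> ('s \<Rightarrow> real) \<Rightarrow> real" where
  "joint \<pi> \<pi>t \<pi>h \<beta> t 0 v = 1"
| "joint \<pi> \<pi>t \<pi>h \<beta> t (Suc i) v =
     joint \<pi> \<pi>t \<pi>h \<beta> t i v * pmf (\<pi> (t (Suc i))) (v (t (Suc i)))
     + pmf (\<pi>t (t (Suc i))) (v (t (Suc i))) * (v (t (Suc i)) - mean (\<pi>t (t (Suc i))))
         / var (\<pi>t (t (Suc i)))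
       * (\<Sum>j=1..i. (\<Prod>k\<in>{1..i} - {j}. pmf (\<pi>h (t k)) (v (t k)))
            * (\<beta> (t (Suc i)) (t j) * pmf (\<pi>t (t j)) (v (t j)) * (v (t j) - mean (\<pi>t (t j)))
                / var (\<pi>t (t j))))"

definition regular ::
  "('s \<Rightarrow> nat) \<Rightarrow> ('s \<Rightarrow> nat \<Rightarrow> real) \<Rightarrow> ('s \<Rightarrow> real pmf) \<Rightarrow> ('s \<Rightarrow> real pmf) \<Rightarrow> ('s \<Rightarrow> real pmf) \<Rightarrow>
    ('s \<Rightarrow> 's \<Rightarrow> real) \<Rightarrow> (nat \<Rightarrow> 's) \<Rightarrow> nat \<Rightarrow> bool" where
  "regular d x \<pi> \<pi>t \<pi>h \<beta> s n \<longleftrightarrow>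
     (\<forall>g i. g permutes {1..n} \<longrightarrow> i \<in> {1..n} \<longrightarrow>
        (let A = (\<Pi>\<^sub>E r\<in>(s \<circ> g) ` {1..i}. state_set d x r) in
          (\<forall>v\<in>A. 0 \<le> joint \<pi> \<pi>t \<pi>h \<beta> (s \<circ> g) i v) \<and>
          (\<Sum>v\<in>A. joint \<pi> \<pi>t \<pi>h \<beta> (s \<circ> g) i v) = 1))"

definition permutation_property ::
  "('s \<Rightarrow> nat) \<Rightarrow> ('s \<Rightarrow> nat \<Rightarrow> real) \<Rightarrow> ('s \<Rightarrow> real pmf) \<Rightarrow> ('s \<Rightarrow> real pmf) \<Rightarrow> ('s \<Rightarrow> real pmf) \<Rightarrow>
    ('s \<Rightarrow> 's \<Rightarrow> real) \<Rightarrow> (nat \<Rightarrow> 's) \<Rightarrow> nat \<Rightarrow> bool" where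
  "permutation_property d x \<pi> \<pi>t \<pi>h \<beta> s n \<longleftrightarrow>
     (\<forall>g h v. g permutes {1..n} \<longrightarrow> h permutes {1..n} \<longrightarrow>
        (\<forall>i\<in>{1..n}. v (s i) \<in> state_set d x (s i)) \<longrightarrow>
        joint \<pi> \<pi>t \<pi>h \<beta> (s \<circ> g) n v = joint \<pi> \<pi>t \<pi>h \<beta> (s \<circ> h) n v)"

definition closed_form ::
  "('s \<Rightarrow> nat) \<Rightarrow> ('s \<Rightarrow> nat \<Rightarrow> real) \<Rightarrow> ('s \<Rightarrow> real pmf) \<Rightarrow> ('s \<Rightarrow> real pmf) \<Rightarrow> ('s \<Rightarrow> real pmf) \<Rightarrow>
    ('s \<Rightarrow> 's \<Rightarrow> real) \<Rightarrow> (nat \<Rightarrow> 's) \<Rightarrow> nat \<Rightarrow> nat \<Rightarrow> real \<Rightarrow> bool" where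
  "closed_form d x \<pi> \<pi>t \<pi>h \<beta> s n uc y \<longleftrightarrow>
     (\<forall>u\<in>{1..d (s 1)}. yh x \<pi> \<pi>h (s 1) u = zt x \<pi>t (s 1) u * y / zt x \<pi>t (s 1) uc) \<and>
     (\<forall>i\<in>{2..n - 1}. \<forall>u\<in>{1..d (s i)}.
        yh x \<pi> \<pi>h (s i) u =
          rho \<pi>t \<beta> (s i) (s n) * zt x \<pi>t (s i) u * y
            / (rho \<pi>t \<beta> (s 1) (s n) * zt x \<pi>t (s 1) uc)) \<and>
     (\<forall>u\<in>{1..d (s n)}.
        yh x \<pi> \<pi>h (s n) u =
          rho \<pi>t \<beta> (s 2) (s n) * zt x \<pi>t (s n) u * y
            / (rho \<pi>t \<beta> (s 1) (s 2) * zt x \<pi>t (s 1) uc))"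

end

theory Submission
  imports Defs
begin

text \<open>
  Exchanging the last two sites \<open>a\<close>, \<open>b\<close> of an ordering changes the joint pmf by
  \<open>y\<^sub>b F a - y\<^sub>a F b\<close>, where \<open>y = \<pi>h - \<pi>\<close> and \<open>F a\<close> is the correction that \<open>a\<close> would add to the sites
  already visited. As \<open>\<pi> > 0\<close> and no \<open>\<pi>t\<close> is degenerate, the permutation property is therefore
  equivalent to the system \<open>\<beta> b j * w\<^sub>b * y\<^sub>a = \<beta> a j * w\<^sub>a * y\<^sub>b\<close> over triples of distinct sites, with
  \<open>w\<close> the weight \<open>\<pi>t * (c - mean) / var\<close>: triples suffice, because \<open>F\<close> is a sum over the visited
  sites \<open>j\<close>.

  The conditions on the correlations say that \<open>\<beta>\<close> has the form
  \<open>\<beta> (s i) (s j) = D * \<beta> (s 1) (s i) * \<beta> (s 1) (s j)\<close> off the site \<open>s 1\<close>, and the closed form says that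
  \<open>y\<close> is proportional to \<open>w\<close> at every site, with ratios \<open>\<kappa>\<close> at \<open>s 1\<close> and \<open>D * \<beta> (s 1) (s i) * \<kappa>\<close> at
  \<open>s i\<close>. If \<open>D \<noteq> 0\<close> the system forces this proportionality; if \<open>D = 0\<close> it leaves \<open>y\<close> at \<open>s 1\<close> free,
  and proportionality there holds for two states because \<open>y\<close> and \<open>w\<close> both have sum zero.
\<close>

section \<open>Sequential joint function along a list of sites, and its independence of the
  order\<close>

text \<open>The visited sites enter as a set \<open>T\<close>, since the correction does not depend
  on their order.\<close>

definition cov_term ::
  "('s \<Rightarrow> real) \<Rightarrow> ('s \<Rightarrow> real) \<Rightarrow> ('s \<Rightarrow> 's \<Rightarrow> real) \<Rightarrow> 's set \<Rightarrow> 's \<Rightarrow> real" where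
  "cov_term q w \<beta> T a = w a * (\<Sum>j\<in>T. (\<Prod>k\<in>T - {j}. q k) * (\<beta> a j * w j))"

text \<open>The head of the list is the site visited last.\<close>

primrec seq_joint ::
  "('s \<Rightarrow> real) \<Rightarrow> ('s \<Rightarrow> real) \<Rightarrow> ('s \<Rightarrow> real) \<Rightarrow> ('s \<Rightarrow> 's \<Rightarrow> real) \<Rightarrow> 's list \<Rightarrow> real" where
  "seq_joint p q w \<beta> [] = 1"
| "seq_joint p q w \<beta> (a # as) = seq_joint p q w \<beta> as * p a + cov_term q w \<beta> (set as) a"

text \<open>The summand of \<open>b\<close> carries the product over all of \<open>T\<close>; every
  other summand just gains the factor \<open>q b\<close>.\<close>

lemma cov_term_insert:
  assumes "finite T" "b \<notin> T"
  shows "cov_term q w \<beta> (insert b T) a = \<beta> a b * w a * w b * (\<Prod>k\<in>T. q k) + q b * cov_term q w \<beta> T a"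
proof -
  have "(\<Prod>k\<in>insert b T - {j}. q k) = q b * (\<Prod>k\<in>T - {j}. q k)" if "j \<in> T" for j
    using assms that by (auto simp: insert_Diff_if)
  then have "(\<Sum>j\<in>T. (\<Prod>k\<in>insert b T - {j}. q k) * (\<beta> a j * w j))
      = q b * (\<Sum>j\<in>T. (\<Prod>k\<in>T - {j}. q k) * (\<beta> a j * w j))"
    by (simp add: sum_distrib_left algebra_simps)
  then show ?thesis
    using assms by (simp add: cov_term_def algebra_simps)
qed

text \<open>The terms containing \<open>p a * p b\<close> and, by symmetry, those containing
  \<open>\<beta> a b\<close> are common to both orders and cancel.\<close>

lemma seq_joint_swap_diff:
  assumes "distinct (a # b # as)" "\<beta> a b = \<beta> b a"
  shows "seq_joint p q w \<beta> (a # b # as) - seq_joint p q w \<beta> (b # a # as)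
    = cov_term q w \<beta> (set as) a * (q b - p b) - cov_term q w \<beta> (set as) b * (q a - p a)"
  using assms by (simp add: cov_term_insert algebra_simps)

text \<open>The sites of \<open>as\<close> are visited after those of \<open>bs\<close>. Each such
  step multiplies by \<open>p a\<close> and adds a quantity depending only on the set of earlier
  sites, so it is injective.\<close>

lemma seq_joint_append_eqD:
  assumes "seq_joint p q w \<beta> (as @ bs) = seq_joint p q w \<beta> (as @ bs')"
    and "set bs = set bs'" and "\<And>a. a \<in> set as \<Longrightarrow> p a \<noteq> 0"
  shows "seq_joint p q w \<beta> bs = seq_joint p q w \<beta> bs'"
  using assms by (induction as) auto

text \<open>Induction on the length. Equal heads are removed. For distinct heads \<open>a\<close>,
  \<open>b\<close>, the induction hypothesis rearranges the tails so that the lists become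
  \<open>a # b # zs\<close> and \<open>b # a # zs\<close>, which differ by one swap.\<close>

lemma seq_joint_order_invariant:
  assumes sym: "\<And>a b. a \<in> A \<Longrightarrow> b \<in> A \<Longrightarrow> a \<noteq> b \<Longrightarrow> \<beta> a b = \<beta> b a"
    and balance: "\<And>a b j. a \<in> A \<Longrightarrow> b \<in> A \<Longrightarrow> j \<in> A \<Longrightarrow> a \<noteq> b \<Longrightarrow> a \<noteq> j \<Longrightarrow> b \<noteq> j \<Longrightarrow>
      \<beta> b j * w b * (q a - p a) = \<beta> a j * w a * (q b - p b)"
    and "distinct as" "distinct bs" "set as = set bs" "set as \<subseteq> A"
  shows "seq_joint p q w \<beta> as = seq_joint p q w \<beta> bs"
  using assms(3-)
proof (induction "length as" arbitrary: as bs)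
  case 0
  then show ?case by simp
next
  case (Suc m)
  then obtain a as' where as: "as = a # as'" by (cases as) auto
  with Suc obtain b bs' where bs: "bs = b # bs'" by (cases bs) auto
  show ?case
  proof (cases "a = b")
    case True
    then have "set as' = set bs'"
      using Suc.prems as bs by auto
    with Suc.hyps(1)[of as' bs'] Suc.hyps(2) Suc.prems True show ?thesis
      by (simp add: as bs)
  next
    case False
    obtain zs where zs: "set zs = set as - {a, b}" "distinct zs"
      using finite_distinct_list[of "set as - {a, b}"] by auto
    have sa: "set as' = set (b # zs)" and sb: "set bs' = set (a # zs)"
      using Suc.prems False zs as bs by auto
    have len: "length bs' = length as'"
      using Suc.prems as bs by (metis distinct_card length_Cons nat.inject)
    have ins: "a \<in> A" "b \<in> A" "set zs \<subseteq> A" "a \<notin> set zs" "b \<notin> set zs"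
      using Suc.prems zs as bs by auto
    \<comment> \<open>The swap difference vanishes summand by summand: \<open>balance\<close>
      applies to each triple \<open>a\<close>, \<open>b\<close>, \<open>j\<close>.\<close>
    have "cov_term q w \<beta> (set zs) a * (q b - p b)
        = (\<Sum>j\<in>set zs. (\<Prod>k\<in>set zs - {j}. q k) * w j * (\<beta> a j * w a * (q b - p b)))"
      by (simp add: cov_term_def sum_distrib_left sum_distrib_right mult_ac)
    also have "\<dots> = (\<Sum>j\<in>set zs. (\<Prod>k\<in>set zs - {j}. q k) * w j * (\<beta> b j * w b * (q a - p a)))"
    proof (intro sum.cong refl)
      fix j assume "j \<in> set zs"
      then show "(\<Prod>k\<in>set zs - {j}. q k) * w j * (\<beta> a j * w a * (q b - p b))
        = (\<Prod>k\<in>set zs - {j}. q k) * w j * (\<beta> b j * w b * (q a - p a))"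
        using balance[of a b j] ins False by (metis subset_iff)
    qed
    also have "\<dots> = cov_term q w \<beta> (set zs) b * (q a - p a)"
      by (simp add: cov_term_def sum_distrib_left sum_distrib_right mult_ac)
    finally have swap: "seq_joint p q w \<beta> (a # b # zs) = seq_joint p q w \<beta> (b # a # zs)"
      using seq_joint_swap_diff[of a b zs \<beta> p q w] sym ins False zs by simp
    have "seq_joint p q w \<beta> as' = seq_joint p q w \<beta> (b # zs)"
    proof (rule Suc.hyps(1))
      show "set as' \<subseteq> A" using Suc.prems(4) by (simp add: as)
    qed (use Suc.hyps(2) Suc.prems(1) zs(2) ins sa in \<open>simp_all add: as\<close>)
    moreover have "seq_joint p q w \<beta> bs' = seq_joint p q w \<beta> (a # zs)"
    proof (rule Suc.hyps(1))
      show "set bs' \<subseteq> A" using Suc.prems(3,4) by (simp add: bs)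
    qed (use Suc.hyps(2) Suc.prems(2) zs(2) ins sb len in \<open>simp_all add: as bs\<close>)
    ultimately show ?thesis
      using swap sa sb by (simp only: as bs seq_joint.simps)
  qed
qed

section \<open>From permutations of indices to lists of sites\<close>

text \<open>The site factor as it occurs in \<open>joint\<close>: normalised by the variance,
  whereas \<open>zt\<close> is normalised by the standard deviation.\<close>

definition weight :: "('s \<Rightarrow> real pmf) \<Rightarrow> 's \<Rightarrow> real \<Rightarrow> real" where
  "weight \<pi>t a c = pmf (\<pi>t a) c * (c - mean (\<pi>t a)) / var (\<pi>t a)"

text \<open>The reversal puts the last visited site at the head. Injectivity turns products over
  indices into products over sites.\<close>

lemma joint_eq_seq_joint:
  assumes "inj_on t {1..i}"
  shows "joint \<pi> \<pi>t \<pi>h \<beta> t i v =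
    seq_joint (\<lambda>a. pmf (\<pi> a) (v a)) (\<lambda>a. pmf (\<pi>h a) (v a)) (\<lambda>a. weight \<pi>t a (v a)) \<beta>
      (map t (rev [1..<Suc i]))"
  using assms
proof (induction i)
  case 0
  then show ?case by simp
next
  case (Suc i)
  have inj: "inj_on t {1..i}"
    using Suc.prems by (rule inj_on_subset) auto
  have im: "set (map t (rev [1..<Suc i])) = t ` {1..i}"
    by (auto simp: atLeastLessThanSuc_atLeastAtMost)
  have "(\<Prod>k\<in>t ` {1..i} - {t j}. pmf (\<pi>h k) (v k)) = (\<Prod>k\<in>{1..i} - {j}. pmf (\<pi>h (t k)) (v (t k)))"
    if "j \<in> {1..i}" for j
  proof -
    have "t ` {1..i} - {t j} = t ` ({1..i} - {j})"
      using inj_on_image_set_diff[OF inj, of "{1..i}" "{j}"] that by simp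
    then show ?thesis
      using prod.reindex[OF inj_on_diff[OF inj], of "\<lambda>k. pmf (\<pi>h k) (v k)" "{j}"] by simp
  qed
  then have "cov_term (\<lambda>a. pmf (\<pi>h a) (v a)) (\<lambda>a. weight \<pi>t a (v a)) \<beta> (t ` {1..i}) (t (Suc i))
    = weight \<pi>t (t (Suc i)) (v (t (Suc i))) * (\<Sum>j=1..i. (\<Prod>k\<in>{1..i} - {j}. pmf (\<pi>h (t k)) (v (t k)))
       * (\<beta> (t (Suc i)) (t j) * weight \<pi>t (t j) (v (t j))))"
    using inj by (simp add: cov_term_def sum.reindex)
  moreover have "map t (rev [1..<Suc (Suc i)]) = t (Suc i) # map t (rev [1..<Suc i])"
    by simp
  ultimately show ?case
    using Suc.IH[OF inj] im by (simp only: joint.simps seq_joint.simps) (simp add: weight_def mult.assoc)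
qed

text \<open>The orderings \<open>s \<circ> g\<close> are exactly the repetition-free lists of the
  sites, so arbitrary lists can be compared without constructing permutations.\<close>

lemma permutation_property_iff_seq_joint:
  assumes inj: "inj_on s {1..n}"
  shows "permutation_property d x \<pi> \<pi>t \<pi>h \<beta> s n \<longleftrightarrow>
    (\<forall>v as bs. (\<forall>a\<in>s ` {1..n}. v a \<in> state_set d x a) \<longrightarrow>
       distinct as \<longrightarrow> distinct bs \<longrightarrow> set as = s ` {1..n} \<longrightarrow> set bs = s ` {1..n} \<longrightarrow>
       seq_joint (\<lambda>a. pmf (\<pi> a) (v a)) (\<lambda>a. pmf (\<pi>h a) (v a)) (\<lambda>a. weight \<pi>t a (v a)) \<beta> as =
       seq_joint (\<lambda>a. pmf (\<pi> a) (v a)) (\<lambda>a. pmf (\<pi>h a) (v a)) (\<lambda>a. weight \<pi>t a (v a)) \<beta> bs)"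
    (is "?L \<longleftrightarrow> ?R")
proof -
  define J where "J v = seq_joint (\<lambda>a. pmf (\<pi> a) (v a)) (\<lambda>a. pmf (\<pi>h a) (v a))
    (\<lambda>a. weight \<pi>t a (v a)) \<beta>" for v
  have to_list: "joint \<pi> \<pi>t \<pi>h \<beta> (s \<circ> g) n v = J v (map (s \<circ> g) (rev [1..<Suc n]))
      \<and> distinct (map (s \<circ> g) (rev [1..<Suc n])) \<and> set (map (s \<circ> g) (rev [1..<Suc n])) = s ` {1..n}"
    if "g permutes {1..n}" for g v
  proof -
    have "inj_on (s \<circ> g) {1..n}"
      using inj that by (intro comp_inj_on) (simp_all add: permutes_image permutes_inj_on)
    moreover have "{1..<Suc n} = {1..n}" by auto
    moreover have "(s \<circ> g) ` {1..n} = s ` {1..n}"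
      using permutes_image[OF that] by (simp only: image_comp[symmetric])
    ultimately show ?thesis
      using joint_eq_seq_joint[of "s \<circ> g" n]
      by (simp add: J_def distinct_map del: upt_Suc)
  qed
  have from_list: "\<exists>g. g permutes {1..n} \<and> as = map (s \<circ> g) (rev [1..<Suc n])"
    if as: "distinct as" "set as = s ` {1..n}" for as
  proof -
    have len: "length as = n"
      using distinct_card[OF as(1)] as(2) card_image[OF inj] by simp
    \<comment> \<open>Visiting times start at 1 and list positions at 0, and the head of
      \<open>as\<close> is visited last; hence \<open>rev\<close> and \<open>i - 1\<close>.\<close>
    define f where "f i = inv_into {1..n} s (rev as ! (i - 1))" for i
    \<comment> \<open>\<open>permutes\<close> demands the identity outside
      \<open>{1..n}\<close>.\<close>
    define g where "g i = (if i \<in> {1..n} then f i else i)" for i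
    have mem: "rev as ! (i - 1) \<in> s ` {1..n}" if "i \<in> {1..n}" for i
      using that len as(2) nth_mem[of "i - 1" "rev as"] by (auto simp del: nth_mem)
    have sf: "s (f i) = rev as ! (i - 1)" and fi: "f i \<in> {1..n}" if "i \<in> {1..n}" for i
      using mem[OF that] unfolding f_def by (simp_all only: f_inv_into_f inv_into_into)
    have "inj_on f {1..n}"
    proof (rule inj_onI)
      fix i j assume ij: "i \<in> {1..n}" "j \<in> {1..n}" "f i = f j"
      then have "rev as ! (i - 1) = rev as ! (j - 1)"
        using sf by metis
      then have "i - 1 = j - 1"
        using ij len as(1) by (subst (asm) nth_eq_iff_index_eq) auto
      then show "i = j" using ij by auto
    qed
    then have "bij_betw f {1..n} {1..n}"
      using fi by (metis bij_betw_def endo_inj_surj finite_atLeastAtMost image_subsetI)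
    then have "bij_betw g {1..n} {1..n}"
      by (rule bij_betw_cong[THEN iffD1, rotated]) (simp add: g_def)
    then have "g permutes {1..n}"
      by (rule bij_imp_permutes) (auto simp: g_def)
    moreover have "map (s \<circ> g) [1..<Suc n] = rev as"
      using len by (intro nth_equalityI) (auto simp: g_def sf simp del: upt_Suc)
    then have "map (s \<circ> g) (rev [1..<Suc n]) = as"
      by (metis rev_map rev_rev_ident)
    ultimately show ?thesis by blast
  qed
  have "?L \<longleftrightarrow> (\<forall>v as bs. (\<forall>a\<in>s ` {1..n}. v a \<in> state_set d x a) \<longrightarrow>
       distinct as \<longrightarrow> distinct bs \<longrightarrow> set as = s ` {1..n} \<longrightarrow> set bs = s ` {1..n} \<longrightarrow> J v as = J v bs)"
    (is "_ \<longleftrightarrow> ?R'")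
  proof
    assume L: ?L
    show ?R'
    proof (intro allI impI)
      fix v as bs
      assume v: "\<forall>a\<in>s ` {1..n}. v a \<in> state_set d x a"
        and as: "distinct as" "set as = s ` {1..n}" and bs: "distinct bs" "set bs = s ` {1..n}"
      from from_list[OF as] from_list[OF bs] obtain g h
        where g: "g permutes {1..n}" "as = map (s \<circ> g) (rev [1..<Suc n])"
          and h: "h permutes {1..n}" "bs = map (s \<circ> h) (rev [1..<Suc n])" by blast
      have "joint \<pi> \<pi>t \<pi>h \<beta> (s \<circ> g) n v = joint \<pi> \<pi>t \<pi>h \<beta> (s \<circ> h) n v"
        using L[unfolded permutation_property_def, rule_format, OF g(1) h(1)] v by simp
      then show "J v as = J v bs"
        using to_list[OF g(1), of v] to_list[OF h(1), of v] unfolding g(2) h(2) by simp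
    qed
  next
    assume R: ?R'
    show ?L
      unfolding permutation_property_def
    proof (intro allI impI)
      fix g h v
      assume g: "g permutes {1..n}" and h: "h permutes {1..n}"
        and v: "\<forall>i\<in>{1..n}. v (s i) \<in> state_set d x (s i)"
      have "J v (map (s \<circ> g) (rev [1..<Suc n])) = J v (map (s \<circ> h) (rev [1..<Suc n]))"
        using v to_list[OF g, of v] to_list[OF h, of v] by (intro R[rule_format]) auto
      then show "joint \<pi> \<pi>t \<pi>h \<beta> (s \<circ> g) n v = joint \<pi> \<pi>t \<pi>h \<beta> (s \<circ> h) n v"
        using to_list[OF g, of v] to_list[OF h, of v] by simp
    qed
  qed
  then show ?thesis by (simp only: J_def)
qed

section \<open>Mean and variance of finitely supported pmfs\<close>

lemma integral_pmf_eq_sum: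
  fixes f :: "real \<Rightarrow> real"
  assumes "finite A" "set_pmf p \<subseteq> A"
  shows "measure_pmf.expectation p f = (\<Sum>c\<in>A. pmf p c * f c)"
  using integral_measure_pmf[of A p f] assms by (force simp: set_pmf_iff)

lemma sum_pmf_centered:
  assumes "finite A" "set_pmf p \<subseteq> A"
  shows "(\<Sum>c\<in>A. pmf p c * (c - mean p)) = 0"
proof -
  have "(\<Sum>c\<in>A. pmf p c * (c - mean p)) = (\<Sum>c\<in>A. pmf p c * c) - mean p * (\<Sum>c\<in>A. pmf p c)"
    by (simp add: right_diff_distrib sum_subtractf sum_distrib_left mult_ac)
  also have "\<dots> = 0"
    using integral_pmf_eq_sum[OF assms, of "\<lambda>c. c"] sum_pmf_eq_1[OF assms] by (simp add: mean_def)
  finally show ?thesis .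
qed

lemma ex_ne_mean:
  assumes "\<not> degenerate p"
  obtains c where "c \<in> set_pmf p" "c \<noteq> mean p"
  using assms set_pmf_subset_singleton[of p "mean p"] unfolding degenerate_def by blast

lemma var_pos:
  assumes "finite (set_pmf p)" "\<not> degenerate p"
  shows "var p > 0"
proof -
  obtain c where c: "c \<in> set_pmf p" "c \<noteq> mean p"
    using ex_ne_mean[OF assms(2)] .
  have "var p = (\<Sum>c\<in>set_pmf p. pmf p c * (c - mean p)\<^sup>2)"
    unfolding var_def mean_def[symmetric] by (rule integral_pmf_eq_sum[OF assms(1)]) simp
  also have "\<dots> > 0"
    using c assms(1) by (intro sum_pos2[of _ c]) (auto simp: pmf_positive)
  finally show ?thesis .
qed

section \<open>Weights of the field and the balance equations\<close>

context field_data
begin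

lemma finite_state_set: "finite (state_set d x a)"
  by (simp add: state_set_def)

lemma sd_pos: "a \<in> S \<Longrightarrow> sd (\<pi> a) > 0"
  and sd_aux_pos: "a \<in> S \<Longrightarrow> sd (\<pi>t a) > 0"
  using pi_positive nondegenerate finite_state_set finite_subset[OF pit_support finite_state_set]
  by (auto simp: sd_def intro!: var_pos)

lemma zt_eq_weight: "a \<in> S \<Longrightarrow> zt x \<pi>t a u = sd (\<pi>t a) * weight \<pi>t a (x a u)"
  using sd_aux_pos[of a] real_div_sqrt[of "var (\<pi>t a)"]
  by (simp add: zt_def weight_def sd_def divide_simps)

text \<open>A nondegenerate pmf charges a state other than its mean. This supplies weights that can
  be cancelled from the balance equations.\<close>

lemma ex_weight_nonzero:
  assumes "a \<in> S"
  obtains u where "u \<in> {1..d a}" "weight \<pi>t a (x a u) \<noteq> 0"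
proof -
  obtain c where c: "c \<in> set_pmf (\<pi>t a)" "c \<noteq> mean (\<pi>t a)"
    using ex_ne_mean nondegenerate[OF assms] by metis
  moreover have "var (\<pi>t a) \<noteq> 0"
    using sd_aux_pos[OF assms] by (auto simp: sd_def)
  ultimately have "weight \<pi>t a c \<noteq> 0"
    by (simp add: weight_def set_pmf_iff)
  then show ?thesis
    using c(1) pit_support[OF assms] that by (auto simp: state_set_def)
qed

lemma sum_over_states:
  "a \<in> S \<Longrightarrow> (\<Sum>u\<in>{1..d a}. f (x a u)) = (\<Sum>c\<in>state_set d x a. f c)"
  using distinct_values[of a] by (simp add: state_set_def sum.reindex)

lemma sum_weight:
  assumes "a \<in> S"
  shows "(\<Sum>u\<in>{1..d a}. weight \<pi>t a (x a u)) = 0"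
  using sum_pmf_centered[OF finite_state_set pit_support[OF assms]]
    sum_over_states[OF assms, of "weight \<pi>t a"]
  by (simp add: weight_def sum_divide_distrib[symmetric])

lemma sum_yh:
  assumes "a \<in> S"
  shows "(\<Sum>u\<in>{1..d a}. yh x \<pi> \<pi>h a u) = 0"
  using sum_over_states[OF assms, of "\<lambda>c. pmf (\<pi>h a) c - pmf (\<pi> a) c"]
    sum_pmf_eq_1[OF finite_state_set pih_support[OF assms]]
    sum_pmf_eq_1[OF finite_state_set, of "\<pi> a"] pi_positive[OF assms]
  by (simp add: yh_def sum_subtractf)

text \<open>For necessity, a triple is visited before all other sites, which are then stripped off
  because \<open>\<pi>\<close> is positive. With only \<open>j\<close> visited before the swap, the
  correction is a single product, and the weight of \<open>j\<close> cancels. Sufficiency is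
  \<open>seq_joint_order_invariant\<close>.\<close>

lemma permutation_property_iff_balance:
  assumes inj: "inj_on s {1..n}" and sub: "s ` {1..n} \<subseteq> S"
  shows "permutation_property d x \<pi> \<pi>t \<pi>h \<beta> s n \<longleftrightarrow>
    (\<forall>a\<in>s ` {1..n}. \<forall>b\<in>s ` {1..n}. \<forall>j\<in>s ` {1..n}. a \<noteq> b \<longrightarrow> a \<noteq> j \<longrightarrow> b \<noteq> j \<longrightarrow>
      (\<forall>ua\<in>{1..d a}. \<forall>ub\<in>{1..d b}.
        \<beta> b j * weight \<pi>t b (x b ub) * yh x \<pi> \<pi>h a ua = \<beta> a j * weight \<pi>t a (x a ua) * yh x \<pi> \<pi>h b ub))"
    (is "?L \<longleftrightarrow> ?R")
proof
  assume L: ?L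
  show ?R
  proof (intro ballI impI)
    fix a b j ua ub
    assume abj: "a \<in> s ` {1..n}" "b \<in> s ` {1..n}" "j \<in> s ` {1..n}" "a \<noteq> b" "a \<noteq> j" "b \<noteq> j"
      and u: "ua \<in> {1..d a}" "ub \<in> {1..d b}"
    obtain uj where uj: "uj \<in> {1..d j}" "weight \<pi>t j (x j uj) \<noteq> 0"
      using ex_weight_nonzero abj(3) sub by blast
    have "\<exists>c. c \<in> state_set d x r" if "r \<in> S" for r
      using set_pmf_not_empty[of "\<pi> r"] pi_positive[OF that] by auto
    \<comment> \<open>Any admissible values serve at the sites outside the triple.\<close>
    then obtain v0 where v0: "\<And>r. r \<in> S \<Longrightarrow> v0 r \<in> state_set d x r"
      by metis
    define v where "v = v0(a := x a ua, b := x b ub, j := x j uj)"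
    have v: "v a = x a ua" "v b = x b ub" "v j = x j uj"
      using abj by (auto simp: v_def)
    have vs: "\<forall>r\<in>s ` {1..n}. v r \<in> state_set d x r"
      using v0 sub u uj by (auto simp: v_def state_set_def)
    obtain zs where zs: "set zs = s ` {1..n} - {a, b, j}" "distinct zs"
      using finite_distinct_list[of "s ` {1..n} - {a, b, j}"] by auto
    let ?J = "seq_joint (\<lambda>a. pmf (\<pi> a) (v a)) (\<lambda>a. pmf (\<pi>h a) (v a)) (\<lambda>a. weight \<pi>t a (v a)) \<beta>"
    \<comment> \<open>Read from the right: \<open>j\<close> first, then \<open>a\<close> and
      \<open>b\<close> in either order, then \<open>zs\<close>.\<close>
    have "?J (zs @ [a, b, j]) = ?J (zs @ [b, a, j])"
      using L[unfolded permutation_property_iff_seq_joint[OF inj], rule_format,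
          of v "zs @ [a, b, j]" "zs @ [b, a, j]"] vs zs abj by auto
    then have "?J [a, b, j] = ?J [b, a, j]"
    proof (rule seq_joint_append_eqD)
      fix r assume "r \<in> set zs"
      then have "r \<in> S" "v r \<in> state_set d x r"
        using zs vs sub by auto
      then show "pmf (\<pi> r) (v r) \<noteq> 0"
        using pi_positive[of r] by (simp add: set_pmf_iff[symmetric])
    qed auto
    moreover have "\<beta> a b = \<beta> b a"
      using beta_sym abj sub by blast
    ultimately have "cov_term (\<lambda>a. pmf (\<pi>h a) (v a)) (\<lambda>a. weight \<pi>t a (v a)) \<beta> {j} a * yh x \<pi> \<pi>h b ub
        = cov_term (\<lambda>a. pmf (\<pi>h a) (v a)) (\<lambda>a. weight \<pi>t a (v a)) \<beta> {j} b * yh x \<pi> \<pi>h a ua"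
      using seq_joint_swap_diff[of a b "[j]" \<beta> "\<lambda>a. pmf (\<pi> a) (v a)" "\<lambda>a. pmf (\<pi>h a) (v a)"
          "\<lambda>a. weight \<pi>t a (v a)"] abj
      by (simp add: v yh_def)
    then show "\<beta> b j * weight \<pi>t b (x b ub) * yh x \<pi> \<pi>h a ua = \<beta> a j * weight \<pi>t a (x a ua) * yh x \<pi> \<pi>h b ub"
      using uj(2) by (simp add: cov_term_def v mult_ac)
  qed
next
  assume R: ?R
  show ?L
    unfolding permutation_property_iff_seq_joint[OF inj]
  proof (intro allI impI)
    fix v as bs
    assume vs: "\<forall>a\<in>s ` {1..n}. v a \<in> state_set d x a"
      and lists: "distinct as" "distinct bs" "set as = s ` {1..n}" "set bs = s ` {1..n}"
    show "seq_joint (\<lambda>a. pmf (\<pi> a) (v a)) (\<lambda>a. pmf (\<pi>h a) (v a)) (\<lambda>a. weight \<pi>t a (v a)) \<beta> as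
      = seq_joint (\<lambda>a. pmf (\<pi> a) (v a)) (\<lambda>a. pmf (\<pi>h a) (v a)) (\<lambda>a. weight \<pi>t a (v a)) \<beta> bs"
    proof (rule seq_joint_order_invariant[of "s ` {1..n}"])
      fix a b assume "a \<in> s ` {1..n}" "b \<in> s ` {1..n}" "a \<noteq> b"
      then show "\<beta> a b = \<beta> b a"
        using beta_sym sub by blast
    next
      fix a b j
      assume abj: "a \<in> s ` {1..n}" "b \<in> s ` {1..n}" "j \<in> s ` {1..n}" "a \<noteq> b" "a \<noteq> j" "b \<noteq> j"
      obtain ua ub where u: "ua \<in> {1..d a}" "ub \<in> {1..d b}" and v: "v a = x a ua" "v b = x b ub"
        using vs abj(1,2) unfolding state_set_def by blast
      show "\<beta> b j * weight \<pi>t b (v b) * (pmf (\<pi>h a) (v a) - pmf (\<pi> a) (v a))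
        = \<beta> a j * weight \<pi>t a (v a) * (pmf (\<pi>h b) (v b) - pmf (\<pi> b) (v b))"
        using R[rule_format, OF abj u] unfolding yh_def v .
    qed (use lists in auto)
  qed
qed

end

section \<open>Solving the balance equations under the correlation conditions\<close>

text \<open>On two states the functions of sum zero form a line.\<close>

lemma two_state_proportional:
  fixes f g :: "nat \<Rightarrow> real"
  assumes "(\<Sum>i\<in>{1..2}. f i) = 0" "(\<Sum>i\<in>{1..2}. g i) = 0" "i \<in> {1..2}" "j \<in> {1..2}"
  shows "f i * g j = f j * g i"
proof -
  have split: "{1..2::nat} = {1, 2}" by auto
  have "f 2 = - f 1" "g 2 = - g 1"
    using assms(1,2) unfolding split by (simp_all add: eq_neg_iff_add_eq_0 add.commute)
  moreover have "i = 1 \<or> i = 2" "j = 1 \<or> j = 2"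
    using assms(3,4) by auto
  ultimately show ?thesis by (elim disjE) simp_all
qed

text \<open>If \<open>rho \<pi> \<beta> (s 2) (s n) = 0\<close>, the balance equations make
  \<open>yh\<close> vanish off \<open>s 1\<close> but do not constrain it at \<open>s 1\<close>.
  With three or more states there, sum zero does not force proportionality to \<open>zt\<close>;
  hence the restriction on necessity.\<close>

theorem proposition5p3:
  fixes S :: "'s set" and nbr :: "'s \<Rightarrow> 's set"
    and d :: "'s \<Rightarrow> nat" and x :: "'s \<Rightarrow> nat \<Rightarrow> real"
    and \<pi> \<pi>t \<pi>h :: "'s \<Rightarrow> real pmf" and \<beta> :: "'s \<Rightarrow> 's \<Rightarrow> real"
    and s :: "nat \<Rightarrow> 's" and n uc :: nat
  assumes data: "field_data S nbr d x \<pi> \<pi>t \<pi>h \<beta>"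
    and n: "n \<ge> 3"
    and sites: "inj_on s {1..n}" "s ` {1..n} \<subseteq> S"
    and neighbors: "\<forall>i\<in>{1..n}. \<forall>j\<in>{1..n}. i \<noteq> j \<longrightarrow> s j \<in> nbr (s i)"
    and regularity: "regular d x \<pi> \<pi>t \<pi>h \<beta> s n"
    and rho12: "rho \<pi> \<beta> (s 1) (s 2) \<noteq> 0"
    and rho1n: "rho \<pi> \<beta> (s 1) (s n) \<noteq> 0"
    and uc: "uc \<in> {1..d (s 1)}" "zt x \<pi>t (s 1) uc \<noteq> 0"
    and rho2k: "n \<ge> 4 \<Longrightarrow> \<forall>k\<in>{3..n - 1}. rho \<pi> \<beta> (s 2) (s k) =
        rho \<pi> \<beta> (s 2) (s n) * rho \<pi> \<beta> (s 1) (s k) / rho \<pi> \<beta> (s 1) (s n)"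
    and rhoij: "n \<ge> 4 \<Longrightarrow> \<forall>i\<in>{3..n - 1}. \<forall>j\<in>{3..n - 1}. i \<noteq> j \<longrightarrow> rho \<pi> \<beta> (s i) (s j) =
        rho \<pi> \<beta> (s 1) (s i) * rho \<pi> \<beta> (s 2) (s n) * rho \<pi> \<beta> (s 1) (s j)
          / (rho \<pi> \<beta> (s 1) (s 2) * rho \<pi> \<beta> (s 1) (s n))"
    and rhokn: "n \<ge> 4 \<Longrightarrow> \<forall>k\<in>{3..n - 1}. rho \<pi> \<beta> (s k) (s n) =
        rho \<pi> \<beta> (s 2) (s n) * rho \<pi> \<beta> (s 1) (s k) / rho \<pi> \<beta> (s 1) (s 2)"
  shows "(rho \<pi> \<beta> (s 2) (s n) \<noteq> 0 \<or> d (s 1) = 2 \<longrightarrow>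
           (permutation_property d x \<pi> \<pi>t \<pi>h \<beta> s n \<longleftrightarrow>
             (\<exists>y. closed_form d x \<pi> \<pi>t \<pi>h \<beta> s n uc y))) \<and>
         ((\<exists>y. closed_form d x \<pi> \<pi>t \<pi>h \<beta> s n uc y) \<longrightarrow>
           permutation_property d x \<pi> \<pi>t \<pi>h \<beta> s n)"
proof -
  interpret field_data S nbr d x \<pi> \<pi>t \<pi>h \<beta> by (rule data)
  \<comment> \<open>The value of \<open>D\<close> is dictated by the pair \<open>s 2\<close>,
    \<open>s n\<close>.\<close>
  define D where "D = \<beta> (s 2) (s n) / (\<beta> (s 1) (s 2) * \<beta> (s 1) (s n))"
  define \<theta> where "\<theta> i = (if i = 1 then 1 else D * \<beta> (s 1) (s i))" for i
  let ?w = "\<lambda>i u. weight \<pi>t (s i) (x (s i) u)"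
  let ?y = "\<lambda>i u. yh x \<pi> \<pi>h (s i) u"
  have inS: "s i \<in> S" if "i \<in> {1..n}" for i
    using that sites(2) by (simp add: image_subset_iff)
  have s_ne: "s i \<noteq> s j" if "i \<in> {1..n}" "j \<in> {1..n}" "i \<noteq> j" for i j
    using that sites(1) by (simp add: inj_on_eq_iff)
  have sym: "\<beta> (s i) (s j) = \<beta> (s j) (s i)" if "i \<in> {1..n}" "j \<in> {1..n}" "i \<noteq> j" for i j
    using that by (intro beta_sym inS s_ne)
  have sdp: "sd (\<pi> (s i)) > 0" "sd (\<pi>t (s i)) > 0" if "i \<in> {1..n}" for i
    using sd_pos[OF inS[OF that]] sd_aux_pos[OF inS[OF that]] .
  have beta_ne: "\<beta> (s 1) (s 2) \<noteq> 0" "\<beta> (s 1) (s n) \<noteq> 0"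
    using rho12 rho1n by (auto simp: rho_def)
  have w_uc: "?w 1 uc \<noteq> 0"
    using uc(2) zt_eq_weight[OF inS[of 1]] n by auto

  \<comment> \<open>Each correlation hypothesis covers one position of the pair in
    \<open>2..n\<close>, and the standard deviations of \<open>\<pi>\<close> cancel. For
    \<open>n = 3\<close> only the pair \<open>2\<close>, \<open>n\<close> occurs.\<close>
  have rank_less: "\<beta> (s i) (s j) = D * \<beta> (s 1) (s i) * \<beta> (s 1) (s j)"
    if ij: "2 \<le> i" "i < j" "j \<le> n" for i j
  proof -
    note pos = sdp(1)[of 1] sdp(1)[of 2] sdp(1)[of n] sdp(1)[of i] sdp(1)[of j]
    consider "i = 2" "j = n" | "i = 2" "j \<in> {3..n - 1}" | "i \<in> {3..n - 1}" "j \<in> {3..n - 1}"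
      | "i \<in> {3..n - 1}" "j = n"
      using ij by fastforce
    then show ?thesis
    proof cases
      case 1
      then show ?thesis using beta_ne by (simp add: D_def)
    next
      case 2
      then have "rho \<pi> \<beta> (s 2) (s j) =
          rho \<pi> \<beta> (s 2) (s n) * rho \<pi> \<beta> (s 1) (s j) / rho \<pi> \<beta> (s 1) (s n)"
        using rho2k by auto
      then show ?thesis
        using pos n ij beta_ne \<open>i = 2\<close> by (simp add: D_def rho_def field_simps)
    next
      case 3
      then have "rho \<pi> \<beta> (s i) (s j) = rho \<pi> \<beta> (s 1) (s i) * rho \<pi> \<beta> (s 2) (s n) * rho \<pi> \<beta> (s 1) (s j)
          / (rho \<pi> \<beta> (s 1) (s 2) * rho \<pi> \<beta> (s 1) (s n))"
        using rhoij ij by auto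
      then show ?thesis
        using pos n ij beta_ne by (simp add: D_def rho_def field_simps)
    next
      case 4
      then have "rho \<pi> \<beta> (s i) (s n) =
          rho \<pi> \<beta> (s 2) (s n) * rho \<pi> \<beta> (s 1) (s i) / rho \<pi> \<beta> (s 1) (s 2)"
        using rhokn by auto
      then show ?thesis
        using pos n ij beta_ne \<open>j = n\<close> by (simp add: D_def rho_def field_simps)
    qed
  qed
  have rank: "\<beta> (s i) (s j) = D * \<beta> (s 1) (s i) * \<beta> (s 1) (s j)"
    if "i \<in> {2..n}" "j \<in> {2..n}" "i \<noteq> j" for i j
    using that rank_less[of i j] rank_less[of j i] sym[of i j] by (cases "i < j") auto

  \<comment> \<open>The standard deviations of \<open>\<pi>t\<close> in \<open>rho\<close> cancel
    those in \<open>zt\<close>; by \<open>rank\<close>, the remaining quotient of covariances is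
    \<open>\<theta> i\<close>.\<close>
  have closed: "closed_form d x \<pi> \<pi>t \<pi>h \<beta> s n uc y \<longleftrightarrow>
    (\<forall>i\<in>{1..n}. \<forall>u\<in>{1..d (s i)}. ?y i u = \<theta> i * (y / ?w 1 uc) * ?w i u)" for y
  proof -
    have first: "zt x \<pi>t (s 1) u * y / zt x \<pi>t (s 1) uc = \<theta> 1 * (y / ?w 1 uc) * ?w 1 u" for u
      using zt_eq_weight[OF inS[of 1]] sdp(2)[of 1] n by (simp add: \<theta>_def)
    have mid: "rho \<pi>t \<beta> (s i) (s n) * zt x \<pi>t (s i) u * y
            / (rho \<pi>t \<beta> (s 1) (s n) * zt x \<pi>t (s 1) uc) = \<theta> i * (y / ?w 1 uc) * ?w i u"
      if "i \<in> {2..n - 1}" for i u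
    proof -
      have i: "i \<in> {1..n}" "i \<in> {2..n}" "i \<noteq> n" "i \<noteq> 1"
        using that n by auto
      then show ?thesis
        using zt_eq_weight[OF inS[of 1]] zt_eq_weight[OF inS[OF i(1)]]
          sdp(2)[of 1] sdp(2)[OF i(1)] sdp(2)[of n] rank[OF i(2) _ i(3)] n beta_ne w_uc
        by (simp add: \<theta>_def rho_def field_simps)
    qed
    have last: "rho \<pi>t \<beta> (s 2) (s n) * zt x \<pi>t (s n) u * y
            / (rho \<pi>t \<beta> (s 1) (s 2) * zt x \<pi>t (s 1) uc) = \<theta> n * (y / ?w 1 uc) * ?w n u" for u
      using zt_eq_weight[OF inS[of 1]] zt_eq_weight[OF inS[of n]]
        sdp(2)[of 1] sdp(2)[of 2] sdp(2)[of n] rank[of 2 n] n beta_ne w_uc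
      by (simp add: \<theta>_def rho_def field_simps)
    have split: "{1..n} = insert 1 (insert n {2..n - 1})"
      using n by auto
    have "closed_form d x \<pi> \<pi>t \<pi>h \<beta> s n uc y \<longleftrightarrow>
      (\<forall>u\<in>{1..d (s 1)}. ?y 1 u = \<theta> 1 * (y / ?w 1 uc) * ?w 1 u) \<and>
      (\<forall>i\<in>{2..n - 1}. \<forall>u\<in>{1..d (s i)}. ?y i u = \<theta> i * (y / ?w 1 uc) * ?w i u) \<and>
      (\<forall>u\<in>{1..d (s n)}. ?y n u = \<theta> n * (y / ?w 1 uc) * ?w n u)"
      unfolding closed_form_def first last by (simp only: mid cong: ball_cong)
    then show ?thesis
      unfolding split by blast
  qed

  have balance: "permutation_property d x \<pi> \<pi>t \<pi>h \<beta> s n \<longleftrightarrow>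
    (\<forall>i\<in>{1..n}. \<forall>j\<in>{1..n}. \<forall>k\<in>{1..n}. i \<noteq> j \<longrightarrow> i \<noteq> k \<longrightarrow> j \<noteq> k \<longrightarrow>
      (\<forall>u\<in>{1..d (s i)}. \<forall>u'\<in>{1..d (s j)}.
        \<beta> (s j) (s k) * ?w j u' * ?y i u = \<beta> (s i) (s k) * ?w i u * ?y j u'))"
    unfolding permutation_property_iff_balance[OF sites] Set.ball_simps(9)
    by (intro ball_cong refl) (simp add: inj_on_eq_iff[OF sites(1)])

  have suff: "permutation_property d x \<pi> \<pi>t \<pi>h \<beta> s n" if "closed_form d x \<pi> \<pi>t \<pi>h \<beta> s n uc y" for y
    unfolding balance
  proof (intro ballI impI)
    fix i j k u u'
    assume ijk: "i \<in> {1..n}" "j \<in> {1..n}" "k \<in> {1..n}" "i \<noteq> j" "i \<noteq> k" "j \<noteq> k"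
      and u: "u \<in> {1..d (s i)}" "u' \<in> {1..d (s j)}"
    \<comment> \<open>Once \<open>yh\<close> is a multiple of the weight, both sides carry the same
      weights, and only this identity between coefficients remains.\<close>
    have "\<beta> (s j) (s k) * \<theta> i = \<beta> (s i) (s k) * \<theta> j"
    proof -
      consider "i = 1" | "j = 1" | "k = 1" | "i \<noteq> 1" "j \<noteq> 1" "k \<noteq> 1"
        by blast
      then show ?thesis
      proof cases
        case 1
        then have "\<beta> (s j) (s k) = D * \<beta> (s 1) (s j) * \<beta> (s 1) (s k)"
          using ijk by (intro rank) auto
        with 1 ijk(4) show ?thesis by (simp add: \<theta>_def)
      next
        case 2
        then have "\<beta> (s i) (s k) = D * \<beta> (s 1) (s i) * \<beta> (s 1) (s k)"
          using ijk by (intro rank) auto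
        with 2 ijk(4) show ?thesis by (simp add: \<theta>_def)
      next
        case 3
        have "\<beta> (s j) (s k) = \<beta> (s k) (s j)" "\<beta> (s i) (s k) = \<beta> (s k) (s i)"
          using ijk by (intro sym; simp)+
        with 3 ijk(5,6) show ?thesis by (simp add: \<theta>_def)
      next
        case 4
        then have "\<beta> (s j) (s k) = D * \<beta> (s 1) (s j) * \<beta> (s 1) (s k)"
          "\<beta> (s i) (s k) = D * \<beta> (s 1) (s i) * \<beta> (s 1) (s k)"
          using ijk by (intro rank; auto)+
        with 4 show ?thesis by (simp add: \<theta>_def)
      qed
    qed
    then have "\<beta> (s j) (s k) * \<theta> i * (y / ?w 1 uc * ?w i u * ?w j u')
        = \<beta> (s i) (s k) * \<theta> j * (y / ?w 1 uc * ?w i u * ?w j u')"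
      by (simp only:)
    moreover have "?y i u = \<theta> i * (y / ?w 1 uc) * ?w i u" "?y j u' = \<theta> j * (y / ?w 1 uc) * ?w j u'"
      using that ijk u unfolding closed by blast+
    ultimately show "\<beta> (s j) (s k) * ?w j u' * ?y i u = \<beta> (s i) (s k) * ?w i u * ?y j u'"
      by (simp only: mult_ac)
  qed

  \<comment> \<open>Evaluating the closed form at \<open>s 1\<close> and \<open>uc\<close> shows
    that the free variable must be \<open>?y 1 uc\<close>.\<close>
  have nec: "closed_form d x \<pi> \<pi>t \<pi>h \<beta> s n uc (?y 1 uc)"
    if perm: "permutation_property d x \<pi> \<pi>t \<pi>h \<beta> s n"
      and alt: "rho \<pi> \<beta> (s 2) (s n) \<noteq> 0 \<or> d (s 1) = 2"
    unfolding closed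
  proof (intro ballI)
    fix i u assume i: "i \<in> {1..n}" and u: "u \<in> {1..d (s i)}"
    have bal: "\<beta> (s j) (s k) * ?w j u' * ?y 1 v = \<beta> (s 1) (s k) * ?w 1 v * ?y j u'"
      if "j \<in> {2..n}" "k \<in> {2..n}" "j \<noteq> k" "v \<in> {1..d (s 1)}" "u' \<in> {1..d (s j)}" for j k v u'
      by (rule perm[unfolded balance, rule_format]) (use that n in auto)
    show "?y i u = \<theta> i * (?y 1 uc / ?w 1 uc) * ?w i u"
    proof (cases "i = 1")
      case True
      have "?y 1 u * ?w 1 uc = ?y 1 uc * ?w 1 u"
      proof (cases "rho \<pi> \<beta> (s 2) (s n) = 0")
        case False
        then have "\<beta> (s 2) (s n) \<noteq> 0" by (auto simp: rho_def)
        moreover obtain u2 where u2: "u2 \<in> {1..d (s 2)}" "?w 2 u2 \<noteq> 0"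
          using ex_weight_nonzero[OF inS[of 2]] n by auto
        \<comment> \<open>The equations of the triple 1, 2, \<open>n\<close> at the states
          \<open>u\<close> and \<open>uc\<close>, multiplied crosswise by the weights of
          \<open>s 1\<close>, eliminate \<open>?y 2 u2\<close>.\<close>
        moreover have "\<beta> (s 2) (s n) * ?w 2 u2 * (?y 1 u * ?w 1 uc)
            = \<beta> (s 2) (s n) * ?w 2 u2 * (?y 1 uc * ?w 1 u)"
          using bal[of 2 n u u2] bal[of 2 n uc u2] u2(1) uc(1) u True n
          by (simp add: mult.assoc[symmetric])
        ultimately show ?thesis by simp
      next
        case zero: True
        with alt have d2: "d (s 1) = 2" by simp
        have "s 1 \<in> S" using inS n by simp
        moreover have "u \<in> {1..2}" "uc \<in> {1..2}"
          using u uc(1) True d2 by simp_all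
        ultimately show ?thesis
          using sum_yh[of "s 1"] sum_weight[of "s 1"] unfolding d2
          by (intro two_state_proportional)
      qed
      then show ?thesis
        using w_uc True by (simp add: \<theta>_def field_simps)
    next
      case False
      \<comment> \<open>The third site is \<open>s n\<close>, or \<open>s 2\<close> if
        \<open>i = n\<close>: both have nonzero covariance with \<open>s 1\<close>, which then
        cancels after \<open>rank\<close> is applied.\<close>
      obtain k where k: "k \<in> {2..n}" "k \<noteq> i" "\<beta> (s 1) (s k) \<noteq> 0"
      proof (cases "i = n")
        case True
        with that[of 2] beta_ne n show ?thesis by auto
      next
        case False
        with that[of n] beta_ne n show ?thesis by auto
      qed
      have "\<beta> (s i) (s k) * ?w i u * ?y 1 uc = \<beta> (s 1) (s k) * ?w 1 uc * ?y i u"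
        using bal[of i k uc u] k i False u uc(1) by auto
      then show ?thesis
        using rank[of i k] k i False w_uc by (simp add: \<theta>_def field_simps)
    qed
  qed
  from suff nec show ?thesis by blast
qed

end
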